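(* For every integer $d\ge 1$ there is a constant $C_d$, depending only on $d$, such that for every positive integer $n$, every set $P$ of $n$ points in $\mathbb{R}^d$ admits a geometric spanning tree with crossing number (with respect to hyperplanes) at most $C_d\,n^{1-1/d}$.
   Context: Let $P$ be a finite set of points in $\mathbb{R}^d$. A geometric spanning tree of $P$ is a spanning tree with vertex set $P$ (an acyclic connected graph on $P$), embedded in $\mathbb{R}^d$ by drawing its edges as straight segments connecting the respective end-vertices. Its crossing number with respect to hyperplanes is the maximum number of its edges that are crossed (intersected) by a hyperplane not passing through any point of $P$. *)

theory Defs
  imports "Graph_Theory.Digraph_Component" "HOL-Analysis.Analysis"
begin

text \<open>
  A finite simple graph is a symmetric, loop-free \<open>pair_graph\<close>, in which an undirected edge
  \<open>{u, v}\<close> is represented by the two arcs \<open>(u, v)\<close> and \<open>(v, u)\<close>. The constant \<open>tree\<close> of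
  \<open>Digraph_Component\<close> is not usable here: its acyclicity concerns directed cycles, and going back
  and forth along one edge of a symmetric graph already counts as a cycle (of length 2). The
  cycles of the undirected graph are exactly the cycles of length at least 3.
\<close>

definition undirected_tree :: "'a pair_pre_digraph \<Rightarrow> bool" where
  "undirected_tree T \<longleftrightarrow>
     pair_graph T \<and>
     Digraph_Component.connected (with_proj T) \<and>
     \<not> (\<exists>p. pre_digraph.cycle (with_proj T) p \<and> 3 \<le> length p)"

definition geometric_spanning_tree ::
    "'a::euclidean_space set \<Rightarrow> 'a pair_pre_digraph \<Rightarrow> bool" where
  "geometric_spanning_tree P T \<longleftrightarrow> pverts T = P \<and> undirected_tree T"

definition is_hyperplane :: "'a::euclidean_space set \<Rightarrow> bool" where
  "is_hyperplane H \<longleftrightarrow> (\<exists>a b. a \<noteq> 0 \<and> H = {x. a \<bullet> x = b})"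

text \<open>Edges are collected as unordered pairs, so the two arcs of an edge count once.\<close>

definition crossed_edges ::
    "'a::euclidean_space pair_pre_digraph \<Rightarrow> 'a set \<Rightarrow> 'a set set" where
  "crossed_edges T H = {{u, v} | u v. (u, v) \<in> parcs T \<and> closed_segment u v \<inter> H \<noteq> {}}"

definition crossing_number :: "'a::euclidean_space pair_pre_digraph \<Rightarrow> nat" where
  "crossing_number T =
     Max {card (crossed_edges T H) | H. is_hyperplane H \<and> H \<inter> pverts T = {}}"

text \<open>
  For a finite graph the set of values is finite, and it is nonempty because some hyperplane
  misses all vertices, so the maximum is genuine.
\<close>

lemma finite_crossed_edges:
  assumes "pair_fin_digraph T"
  shows "finite (crossed_edges T H)"
proof (rule finite_subset)
  show "crossed_edges T H \<subseteq> (\<lambda>(u, v). {u, v}) ` parcs T"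
    by (auto simp: crossed_edges_def)
  show "finite ((\<lambda>(u, v). {u, v}) ` parcs T)"
    using assms by (simp add: pair_fin_digraph.pair_finite_arcs)
qed

lemma finite_crossing_values:
  assumes "pair_fin_digraph T"
  shows "finite {card (crossed_edges T H) | H. is_hyperplane H \<and> H \<inter> pverts T = {}}"
proof (rule finite_subset)
  have fin: "finite ((\<lambda>(u, v). {u, v}) ` parcs T)"
    using assms by (simp add: pair_fin_digraph.pair_finite_arcs)
  have "card (crossed_edges T H) \<le> card ((\<lambda>(u, v). {u, v}) ` parcs T)" for H
    by (rule card_mono[OF fin]) (auto simp: crossed_edges_def)
  then show "{card (crossed_edges T H) | H. is_hyperplane H \<and> H \<inter> pverts T = {}}
      \<subseteq> {..card ((\<lambda>(u, v). {u, v}) ` parcs T)}"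
    by auto
qed simp

lemma hyperplane_avoiding_finite:
  fixes P :: "'a::euclidean_space set"
  assumes "finite P"
  shows "\<exists>H. is_hyperplane H \<and> H \<inter> P = {}"
proof -
  obtain a :: 'a where a: "a \<in> Basis"
    using nonempty_Basis by blast
  obtain b where b: "b \<notin> (\<lambda>x. a \<bullet> x) ` P"
    using assms ex_new_if_finite[OF infinite_UNIV_char_0] by blast
  have "is_hyperplane {x. a \<bullet> x = b}"
    using a nonzero_Basis unfolding is_hyperplane_def by blast
  moreover have "{x. a \<bullet> x = b} \<inter> P = {}"
    using b by auto
  ultimately show ?thesis by blast
qed

lemma crossing_number_le_iff:
  fixes T :: "'a::euclidean_space pair_pre_digraph"
  assumes "pair_fin_digraph T"
  shows "crossing_number T \<le> k \<longleftrightarrow>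
    (\<forall>H. is_hyperplane H \<and> H \<inter> pverts T = {} \<longrightarrow> card (crossed_edges T H) \<le> k)"
proof -
  have "{card (crossed_edges T H) | H. is_hyperplane H \<and> H \<inter> pverts T = {}} \<noteq> {}"
    using hyperplane_avoiding_finite[OF pair_fin_digraph.pair_finite_verts[OF assms]] by blast
  then show ?thesis
    unfolding crossing_number_def using Max_le_iff[OF finite_crossing_values[OF assms]] by auto
qed

end

theory Submission
  imports Defs
begin

text \<open>
  The proof is Welzl's iterative reweighting. It suffices that among any \<open>i\<close> of the points some two are
  separated by at most an \<open>O(i powr (- 1 / d))\<close> fraction of any weighted finite collection of hyperplanes
  (\<open>exists_rarely_separated_pair\<close>). Joining such a pair, doubling the weights of the hyperplanes that
  separate it and removing one of the two points, again and again, produces a spanning tree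
  (\<open>reweighted_leaf_tree\<close>). A hyperplane crossing \<open>r\<close> edges ends up with a factor \<open>2 ^ r\<close>, whereas
  the total weight is at most its initial value times the product of the factors
  \<open>1 + O(i powr (- 1 / d))\<close>. Since \<open>n\<close> points are partitioned by hyperplanes in only polynomially many
  ways, \<open>r\<close> is at most of the order of \<open>ln n\<close> plus the sum of the \<open>i powr (- 1 / d)\<close>, that is, of the order
  of \<open>n powr (1 - 1 / d)\<close> when \<open>d \<ge> 2\<close>. On a line the path through the sorted points is crossed at
  most once.

  The rarely separated pair comes from Haussler's packing lemma (\<open>card_le_of_separated\<close>): if any two of
  the points are separated by a \<open>\<delta>\<close> fraction of the weight, there are only \<open>O((1 / \<delta>) ^ d)\<close> points.
  To see this, draw \<open>s\<close> hyperplanes at random and record for each point on which sides it lies. These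
  records form a family of sets that shatters no set of more than \<open>d\<close> hyperplanes, because \<open>d + 1\<close> affine
  functions on a \<open>d\<close>-dimensional space do not attain all sign patterns
  (\<open>not_all_sign_patterns\<close>). Hence there are \<open>O(s ^ d)\<close> records (\<open>card_le_of_vc_less\<close>), and the graph
  joining records that differ in one place is sparse (\<open>sum_card_link_le\<close>). But if there are many more
  points than records, then the last hyperplane drawn still splits many classes of points with equal
  records into large parts, which makes the weight of this graph large when \<open>s\<close> is a large multiple of
  \<open>1 / \<delta>\<close>.
\<close>

section \<open>Trace families of bounded Vapnik--Chervonenkis dimension\<close>

definition shatters :: "'a set set \<Rightarrow> 'a set \<Rightarrow> bool" where
  "shatters F A \<longleftrightarrow> (\<forall>B\<subseteq>A. \<exists>X\<in>F. X \<inter> A = B)"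

text \<open>
  The strict form keeps \<open>k = 0\<close> meaningful: it singles out the empty family, so inductions on \<open>k\<close>
  can pass to links without a side condition.
\<close>

definition vc_less :: "'a set set \<Rightarrow> nat \<Rightarrow> bool" where
  "vc_less F k \<longleftrightarrow> (\<forall>A. finite A \<longrightarrow> shatters F A \<longrightarrow> card A < k)"

text \<open>
  Deletion and link split a family along one element. The link also counts the edges of direction
  \<open>x\<close> in the unit distance graph of the family, whose edges join members differing in one element.
\<close>

definition deletion :: "'a \<Rightarrow> 'a set set \<Rightarrow> 'a set set" where
  "deletion x F = (\<lambda>X. X - {x}) ` F"

definition link :: "'a \<Rightarrow> 'a set set \<Rightarrow> 'a set set" where
  "link x F = {X. x \<notin> X \<and> X \<in> F \<and> insert x X \<in> F}"

text \<open>
  Deleting \<open>x\<close> merges exactly the pairs \<open>X\<close>, \<open>insert x X\<close> that both lie in \<open>F\<close>, and the link has one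
  member for each such pair.
\<close>

lemma card_eq_deletion_link:
  assumes "finite F"
  shows "card F = card (deletion x F) + card (link x F)"
proof -
  define F0 F1 where "F0 = {X \<in> F. x \<notin> X}" and "F1 = {X. x \<notin> X \<and> insert x X \<in> F}"
  have F1: "bij_betw (insert x) F1 {X \<in> F. x \<in> X}"
    by (rule bij_betwI[where g = "\<lambda>X. X - {x}"]) (auto simp: F1_def insert_absorb)
  have "deletion x F = F0 \<union> F1"
  proof
    show "deletion x F \<subseteq> F0 \<union> F1"
    proof
      fix Y assume "Y \<in> deletion x F"
      then obtain X where "X \<in> F" "Y = X - {x}" by (auto simp: deletion_def)
      then show "Y \<in> F0 \<union> F1"
        by (cases "x \<in> X") (auto simp: F0_def F1_def insert_absorb)
    qed
    show "F0 \<union> F1 \<subseteq> deletion x F"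
    proof
      fix X assume "X \<in> F0 \<union> F1"
      then have "X = X - {x}" "X \<in> F \<or> X = insert x X - {x} \<and> insert x X \<in> F"
        by (auto simp: F0_def F1_def)
      then show "X \<in> deletion x F" unfolding deletion_def by blast
    qed
  qed
  moreover have "link x F = F0 \<inter> F1"
    by (auto simp: link_def F0_def F1_def)
  moreover have "finite F0" "finite F1"
    using assms bij_betw_finite[OF F1] by (auto simp: F0_def)
  moreover have "card F = card F0 + card F1"
  proof -
    have "F = F0 \<union> {X \<in> F. x \<in> X}" by (auto simp: F0_def)
    moreover have "card (F0 \<union> {X \<in> F. x \<in> X}) = card F0 + card {X \<in> F. x \<in> X}"
      by (rule card_Un_disjoint) (use assms in \<open>auto simp: F0_def\<close>)
    ultimately show ?thesis using bij_betw_same_card[OF F1] by simp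
  qed
  ultimately show ?thesis
    using card_Un_Int by metis
qed

lemma vc_less_mono: "vc_less F k \<Longrightarrow> F' \<subseteq> F \<Longrightarrow> vc_less F' k"
  unfolding vc_less_def shatters_def by (meson subsetD)

lemma vc_less_0_iff: "vc_less F 0 \<longleftrightarrow> F = {}"
  by (auto simp: vc_less_def shatters_def)

lemma vc_less_deletion:
  assumes "vc_less F k"
  shows "vc_less (deletion x F) k"
  unfolding vc_less_def
proof (intro allI impI)
  fix A assume A: "finite A" "shatters (deletion x F) A"
  have "x \<notin> A"
    using A(2) unfolding shatters_def deletion_def by blast
  then have "(X - {x}) \<inter> A = X \<inter> A" for X by blast
  then have "shatters F A"
    using A(2) by (simp add: shatters_def deletion_def)
  then show "card A < k"
    using A(1) assms by (simp add: vc_less_def)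
qed

text \<open>
  A set shattered by the link can be enlarged by \<open>x\<close>: every trace on it comes from two
  members of the family that differ in \<open>x\<close> only.
\<close>

lemma vc_less_link:
  assumes "vc_less F (Suc k)"
  shows "vc_less (link x F) k"
  unfolding vc_less_def
proof (intro allI impI)
  fix A assume A: "finite A" "shatters (link x F) A"
  have x: "x \<notin> A"
    using A(2) unfolding shatters_def link_def by blast
  have "shatters F (insert x A)"
    unfolding shatters_def
  proof (intro allI impI)
    fix B assume B: "B \<subseteq> insert x A"
    then have "B - {x} \<subseteq> A" by blast
    then obtain X where X: "X \<in> link x F" "X \<inter> A = B - {x}"
      using A(2) unfolding shatters_def by blast
    show "\<exists>X\<in>F. X \<inter> insert x A = B"
    proof (cases "x \<in> B")
      case True
      then have "insert x X \<inter> insert x A = B" using X(2) by blast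
      then show ?thesis using X(1) unfolding link_def by blast
    next
      case False
      then have "X \<inter> insert x A = B" using X B unfolding link_def by blast
      then show ?thesis using X(1) unfolding link_def by blast
    qed
  qed
  then have "card (insert x A) < Suc k"
    using A(1) assms unfolding vc_less_def by blast
  then show "card A < k" using x A(1) by simp
qed

text \<open>
  A weak form of the Sauer--Shelah lemma, with the exponent that is essential here: when
  \<open>x\<close> joins a ground set of \<open>s\<close> elements, the deletion contributes \<open>(s + 1) ^ d\<close> and the link, of smaller
  dimension, only \<open>(s + 1) ^ (d - 1)\<close>, together at most \<open>(s + 2) ^ d\<close>.
\<close>

lemma card_le_of_vc_less:
  assumes "finite S" "F \<subseteq> Pow S" "vc_less F (Suc d)"
  shows "card F \<le> (card S + 1) ^ d"
  using assms
proof (induction S arbitrary: F d rule: finite_induct)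
  case empty
  then have "card F \<le> card {{} :: 'a set}" by (intro card_mono) auto
  then show ?case by simp
next
  case (insert x S)
  have fin: "finite F" using insert.prems(1) insert.hyps(1) by (meson finite.insertI finite_Pow_iff finite_subset)
  have del: "card (deletion x F) \<le> (card S + 1) ^ d"
    using insert.prems by (intro insert.IH vc_less_deletion) (auto simp: deletion_def)
  have card: "card F = card (deletion x F) + card (link x F)"
    by (rule card_eq_deletion_link[OF fin])
  show ?case
  proof (cases d)
    case 0
    then have "link x F = {}" using vc_less_link insert.prems(2) vc_less_0_iff by metis
    then show ?thesis using card del 0 by simp
  next
    case (Suc e)
    have "card (link x F) \<le> (card S + 1) ^ e"
      using insert.prems Suc by (intro insert.IH vc_less_link) (auto simp: link_def)
    then have "card F \<le> (card S + 1) ^ e * (card S + 2)"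
      using card del Suc by (simp add: algebra_simps)
    also have "\<dots> \<le> (card S + 2) ^ e * (card S + 2)"
      by (intro mult_right_mono power_mono) auto
    finally show ?thesis using Suc insert.hyps by (simp add: algebra_simps)
  qed
qed

text \<open>
  Haussler's edge bound: the unit distance graph has at most \<open>k\<close> edges per member. Edges of
  direction \<open>x\<close> are counted by the link of \<open>x\<close>; every other edge survives the deletion of \<open>x\<close>, and two
  edges that become equal there form an edge of the link of \<open>x\<close>. Since the link satisfies the hypothesis
  with \<open>k - 1\<close>, it has room for the edges of direction \<open>x\<close>.
\<close>

lemma sum_card_link_le:
  assumes "finite S" "F \<subseteq> Pow S" "vc_less F k"
  shows "(\<Sum>y\<in>S. card (link y F)) \<le> k * card F"
  using assms
proof (induction S arbitrary: F k rule: finite_induct)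
  case empty
  then show ?case by simp
next
  case (insert x S)
  have fin: "finite F" using insert.prems(1) insert.hyps(1) by (meson finite.insertI finite_Pow_iff finite_subset)
  show ?case
  proof (cases k)
    case 0
    then have "F = {}" using insert.prems(2) vc_less_0_iff by blast
    then show ?thesis by (simp add: link_def)
  next
    case (Suc e)
    have "card (link y F) \<le> card (link y (deletion x F)) + card (link y (link x F))" if "y \<in> S" for y
    proof -
      have xy: "x \<noteq> y" using that insert.hyps by blast
      have finl: "finite (link y F)" using fin by (rule rev_finite_subset) (auto simp: link_def)
      have "deletion x (link y F) \<subseteq> link y (deletion x F)"
      proof
        fix X assume "X \<in> deletion x (link y F)"
        then obtain Y where Y: "X = Y - {x}" "y \<notin> Y" "Y \<in> F" "insert y Y \<in> F"
          by (auto simp: deletion_def link_def)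
        then have "insert y X = insert y Y - {x}" using xy by blast
        then show "X \<in> link y (deletion x F)" using Y by (auto simp: deletion_def link_def)
      qed
      moreover have "finite (link y (deletion x F))"
        by (rule finite_subset[of _ "deletion x F"]) (use fin in \<open>auto simp: link_def deletion_def\<close>)
      ultimately have "card (deletion x (link y F)) \<le> card (link y (deletion x F))"
        by (intro card_mono)
      moreover have "link x (link y F) = link y (link x F)"
        using xy by (auto simp: link_def insert_commute)
      ultimately show ?thesis using card_eq_deletion_link[OF finl, of x] by simp
    qed
    then have "(\<Sum>y\<in>S. card (link y F))
        \<le> (\<Sum>y\<in>S. card (link y (deletion x F))) + (\<Sum>y\<in>S. card (link y (link x F)))"
      by (simp add: sum_mono flip: sum.distrib)
    also have "\<dots> \<le> k * card (deletion x F) + e * card (link x F)"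
      using insert.prems Suc
      by (intro add_mono insert.IH vc_less_deletion vc_less_link) (auto simp: deletion_def link_def)
    finally have "(\<Sum>y\<in>insert x S. card (link y F))
        \<le> card (link x F) + (k * card (deletion x F) + e * card (link x F))"
      using insert.hyps by simp
    also have "\<dots> = k * card F"
      using card_eq_deletion_link[OF fin, of x] Suc by (simp add: algebra_simps)
    finally show ?thesis .
  qed
qed

text \<open>
  The weighted edge bound, where a member weighs as much as its fibre and an edge as much as its
  lighter end. Slicing the weights horizontally reduces it to the unweighted bound for the families
  of members of weight at least \<open>t\<close>.
\<close>

lemma sum_min_fibres_le:
  fixes tr :: "'p \<Rightarrow> 'i set"
  assumes fV: "finite V" and fI: "finite I" and tr: "\<And>p. p \<in> V \<Longrightarrow> tr p \<subseteq> I"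
    and vc: "vc_less (tr ` V) k"
  defines "m \<equiv> \<lambda>B. card {p \<in> V. tr p = B}"
  shows "(\<Sum>i\<in>I. \<Sum>B\<in>Pow (I - {i}). min (m B) (m (insert i B))) \<le> k * card V"
proof -
  \<comment> \<open>The family at level \<open>t\<close>; an edge of weight \<open>a\<close> is an edge at the levels \<open>1, \<dots>, a\<close>.\<close>
  define L where "L t = {B \<in> tr ` V. t \<le> m B}" for t
  define T where "T = {1..card V}"
  have fin: "finite (L t)" for t using fV by (simp add: L_def)
  have m_le: "m B \<le> card V" for B unfolding m_def using fV by (intro card_mono) auto
  have m0: "m B = 0" if "B \<notin> tr ` V" for B
    unfolding m_def using that by (simp add: card_eq_0_iff) blast
  have Lmem: "B \<in> L t \<longleftrightarrow> t \<le> m B" if "t \<in> T" for B t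
    using that m0[of B] by (cases "B \<in> tr ` V") (auto simp: L_def T_def)
  have m_eq: "m B = (\<Sum>t\<in>T. if B \<in> L t then 1 else 0)" for B
  proof -
    have "(\<Sum>t\<in>T. if B \<in> L t then 1 else 0) = (\<Sum>t\<in>T. if t \<le> m B then 1 else 0 :: nat)"
      by (intro sum.cong) (auto simp: Lmem)
    also have "\<dots> = card {t \<in> T. t \<le> m B}" by (simp add: T_def sum.If_cases Int_def)
    also have "{t \<in> T. t \<le> m B} = {1..m B}" using m_le[of B] by (auto simp: T_def)
    finally show ?thesis by simp
  qed
  have min_eq: "min (m B) (m (insert i B)) = (\<Sum>t\<in>T. if B \<in> link i (L t) then 1 else 0)"
    if "i \<notin> B" for i B
  proof -
    have "(\<Sum>t\<in>T. if B \<in> link i (L t) then 1 else 0)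
        = (\<Sum>t\<in>T. if t \<le> min (m B) (m (insert i B)) then 1 else 0 :: nat)"
      using that by (intro sum.cong) (auto simp: Lmem link_def)
    also have "\<dots> = card {t \<in> T. t \<le> min (m B) (m (insert i B))}"
      by (simp add: T_def sum.If_cases Int_def)
    also have "{t \<in> T. t \<le> min (m B) (m (insert i B))} = {1..min (m B) (m (insert i B))}"
      using m_le[of B] by (auto simp: T_def)
    finally show ?thesis by simp
  qed
  have LI: "L t \<subseteq> Pow I" for t using tr by (auto simp: L_def)
  have "(\<Sum>B\<in>Pow (I - {i}). min (m B) (m (insert i B))) = (\<Sum>t\<in>T. card (link i (L t)))" for i
  proof -
    have "(\<Sum>B\<in>Pow (I - {i}). min (m B) (m (insert i B)))
        = (\<Sum>B\<in>Pow (I - {i}). \<Sum>t\<in>T. if B \<in> link i (L t) then 1 else 0)"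
      by (intro sum.cong min_eq) auto
    also have "\<dots> = (\<Sum>t\<in>T. \<Sum>B\<in>Pow (I - {i}). if B \<in> link i (L t) then 1 else 0)"
      by (rule sum.swap)
    also have "\<dots> = (\<Sum>t\<in>T. card (link i (L t)))"
    proof (intro sum.cong refl)
      fix t
      have "Pow (I - {i}) \<inter> link i (L t) = link i (L t)"
        using LI[of t] by (auto simp: link_def)
      then show "(\<Sum>B\<in>Pow (I - {i}). if B \<in> link i (L t) then 1 else 0) = card (link i (L t))"
        using fI by (simp add: sum.If_cases)
    qed
    finally show ?thesis .
  qed
  then have "(\<Sum>i\<in>I. \<Sum>B\<in>Pow (I - {i}). min (m B) (m (insert i B)))
      = (\<Sum>t\<in>T. \<Sum>i\<in>I. card (link i (L t)))"
    by (simp add: sum.swap[of _ I T])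
  also have "\<dots> \<le> (\<Sum>t\<in>T. k * card (L t))"
    by (intro sum_mono sum_card_link_le fI LI vc_less_mono[OF vc]) (auto simp: L_def)
  also have "\<dots> = k * (\<Sum>B\<in>tr ` V. m B)"
  proof -
    have "(\<Sum>B\<in>tr ` V. m B) = (\<Sum>t\<in>T. \<Sum>B\<in>tr ` V. if B \<in> L t then 1 else 0)"
      by (simp only: m_eq sum.swap[of _ T])
    also have "\<dots> = (\<Sum>t\<in>T. card (L t))"
    proof (intro sum.cong refl)
      fix t
      have "tr ` V \<inter> L t = L t" by (auto simp: L_def)
      then show "(\<Sum>B\<in>tr ` V. if B \<in> L t then 1 else 0) = card (L t)"
        using fV by (simp add: sum.If_cases)
    qed
    finally show ?thesis by (simp add: sum_distrib_left)
  qed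
  also have "(\<Sum>B\<in>tr ` V. m B) = card V"
    using sum.image_gen[OF fV, of "\<lambda>_. 1 :: nat" tr] by (simp add: m_def)
  finally show ?thesis .
qed

section \<open>The packing lemma\<close>

definition separating_weight :: "'p set set \<Rightarrow> ('p set \<Rightarrow> real) \<Rightarrow> 'p \<Rightarrow> 'p \<Rightarrow> real" where
  "separating_weight X w x y = (\<Sum>R\<in>X. if (x \<in> R) \<noteq> (y \<in> R) then w R else 0)"

text \<open>
  Ranges and points exchange roles: each point becomes the set of ranges containing it.
\<close>

definition dual_family :: "'p set set \<Rightarrow> 'p set \<Rightarrow> 'p set set set" where
  "dual_family X V = (\<lambda>p. {R \<in> X. p \<in> R}) ` V"

text \<open>
  A random range splits \<open>Q\<close> into parts of sizes \<open>b0\<close> and \<open>b1\<close>. The minimum is controlled by the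
  number \<open>2 * b0 * b1 \<le> 2 * card Q * min b0 b1\<close> of ordered pairs that are separated, and every
  pair is separated with probability at least \<open>\<delta>\<close>.
\<close>

lemma expected_min_split_ge:
  assumes fQ: "finite Q" and ne: "Q \<noteq> {}" and w: "\<And>R. R \<in> X \<Longrightarrow> 0 \<le> w R"
    and sep: "\<And>x y. x \<in> Q \<Longrightarrow> y \<in> Q \<Longrightarrow> x \<noteq> y \<Longrightarrow> \<delta> \<le> separating_weight X w x y"
  shows "\<delta> / 2 * (real (card Q) - 1)
    \<le> (\<Sum>R\<in>X. w R * real (min (card {p \<in> Q. p \<notin> R}) (card {p \<in> Q. p \<in> R})))"
proof -
  define b where "b = real (card Q)"
  have b: "b > 0" using fQ ne by (simp add: b_def card_gt_0_iff)
  have pairs: "(\<Sum>x\<in>Q. \<Sum>y\<in>Q. if (x \<in> R) \<noteq> (y \<in> R) then 1 else 0)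
      \<le> 2 * b * real (min (card {p \<in> Q. p \<notin> R}) (card {p \<in> Q. p \<in> R}))" for R
  proof -
    define b0 b1 where "b0 = real (card {p \<in> Q. p \<notin> R})" and "b1 = real (card {p \<in> Q. p \<in> R})"
    have "card Q = card ({p \<in> Q. p \<notin> R} \<union> {p \<in> Q. p \<in> R})"
      by (rule arg_cong[where f = card]) auto
    also have "\<dots> = card {p \<in> Q. p \<notin> R} + card {p \<in> Q. p \<in> R}"
      by (rule card_Un_disjoint) (use fQ in auto)
    finally have bb: "b = b0 + b1" by (simp add: b_def b0_def b1_def)
    have in1: "(\<Sum>y\<in>Q. if (x \<in> R) \<noteq> (y \<in> R) then 1 else 0) = (if x \<in> R then b0 else b1)" for x
      using fQ by (simp add: sum.If_cases Int_def b0_def b1_def)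
    have "(\<Sum>x\<in>Q. \<Sum>y\<in>Q. if (x \<in> R) \<noteq> (y \<in> R) then 1 else 0) = b1 * b0 + b0 * b1"
      unfolding in1 using fQ by (simp add: sum.If_cases Int_def b0_def b1_def)
    also have "\<dots> = 2 * max b0 b1 * min b0 b1" by (simp add: max_def min_def)
    also have "\<dots> \<le> 2 * b * min b0 b1"
      unfolding bb by (intro mult_mono) (auto simp: b0_def b1_def)
    also have "min b0 b1 = real (min (card {p \<in> Q. p \<notin> R}) (card {p \<in> Q. p \<in> R}))"
      by (simp add: b0_def b1_def)
    finally show ?thesis .
  qed
  have "\<delta> * (b * (b - 1)) = (\<Sum>x\<in>Q. \<Sum>y\<in>Q - {x}. \<delta>)"
    using fQ b by (simp add: b_def card_Diff_singleton_if of_nat_diff algebra_simps Suc_leI)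
  also have "\<dots> \<le> (\<Sum>x\<in>Q. \<Sum>y\<in>Q - {x}. separating_weight X w x y)"
    by (intro sum_mono sep) auto
  also have "\<dots> = (\<Sum>x\<in>Q. \<Sum>y\<in>Q. separating_weight X w x y)"
    using fQ by (intro sum.cong refl sum.mono_neutral_left) (auto simp: separating_weight_def)
  also have "\<dots> = (\<Sum>x\<in>Q. \<Sum>R\<in>X. \<Sum>y\<in>Q. w R * (if (x \<in> R) \<noteq> (y \<in> R) then 1 else 0))"
    by (intro sum.cong refl) (subst sum.swap, auto simp: separating_weight_def intro!: sum.cong)
  also have "\<dots> = (\<Sum>R\<in>X. w R * (\<Sum>x\<in>Q. \<Sum>y\<in>Q. if (x \<in> R) \<noteq> (y \<in> R) then 1 else 0))"
    by (subst sum.swap) (simp only: sum_distrib_left)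
  also have "\<dots> \<le> (\<Sum>R\<in>X. w R *
      (2 * b * real (min (card {p \<in> Q. p \<notin> R}) (card {p \<in> Q. p \<in> R}))))"
    by (intro sum_mono mult_left_mono pairs w)
  also have "\<dots> = 2 * b *
      (\<Sum>R\<in>X. w R * real (min (card {p \<in> Q. p \<notin> R}) (card {p \<in> Q. p \<in> R})))"
    by (simp add: sum_distrib_left algebra_simps)
  finally have "b * (\<delta> * (b - 1)) \<le> b * (2 *
      (\<Sum>R\<in>X. w R * real (min (card {p \<in> Q. p \<notin> R}) (card {p \<in> Q. p \<in> R}))))"
    by (simp add: algebra_simps)
  then show ?thesis using b by (simp add: b_def)
qed

text \<open>
  Ranges are sampled with repetition, as families \<open>h\<close> indexed by \<open>I\<close>, so traces are sets of
  indices and not sets of ranges.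
\<close>

definition index_trace :: "'i set \<Rightarrow> ('i \<Rightarrow> 'p set) \<Rightarrow> 'p \<Rightarrow> 'i set" where
  "index_trace I h p = {i \<in> I. p \<in> h i}"

definition fibre_size :: "'p set \<Rightarrow> 'i set \<Rightarrow> ('i \<Rightarrow> 'p set) \<Rightarrow> 'i set \<Rightarrow> nat" where
  "fibre_size V I h B = card {p \<in> V. index_trace I h p = B}"

text \<open>
  The probability of the sample \<open>h\<close> when its entries are drawn independently with distribution \<open>w\<close>.
\<close>

definition sample_weight :: "('p set \<Rightarrow> real) \<Rightarrow> 'i set \<Rightarrow> ('i \<Rightarrow> 'p set) \<Rightarrow> real" where
  "sample_weight w I h = (\<Prod>i\<in>I. w (h i))"

text \<open>
  Repeated ranges do no harm: two indices carrying the same range are never told apart by a point, so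
  a shattered index set carries distinct ranges.
\<close>

lemma vc_less_index_traces:
  assumes vc: "vc_less (dual_family X V) k" and fX: "finite X" and h: "h \<in> I \<rightarrow> X"
  shows "vc_less (index_trace I h ` V) k"
  unfolding vc_less_def
proof (intro allI impI)
  fix A assume A: "finite A" "shatters (index_trace I h ` V) A"
  have tr: "\<exists>p\<in>V. index_trace I h p \<inter> A = B" if "B \<subseteq> A" for B
    using A(2) that unfolding shatters_def by blast
  have AI: "A \<subseteq> I" using tr[of A] unfolding index_trace_def by blast
  have inj: "inj_on h A"
  proof (rule inj_onI)
    fix i j assume ij: "i \<in> A" "j \<in> A" "h i = h j"
    obtain p where p: "index_trace I h p \<inter> A = {i}" using tr[of "{i}"] ij by blast
    then have "p \<in> h j" using ij(3) by (auto simp: index_trace_def)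
    then have "j \<in> index_trace I h p \<inter> A" using ij(2) AI by (auto simp: index_trace_def)
    then show "i = j" using p by simp
  qed
  have "shatters (dual_family X V) (h ` A)"
    unfolding shatters_def
  proof (intro allI impI)
    fix B assume B: "B \<subseteq> h ` A"
    obtain p where p: "p \<in> V" "index_trace I h p \<inter> A = {i \<in> A. h i \<in> B}"
      using tr[of "{i \<in> A. h i \<in> B}"] by auto
    have "{R \<in> X. p \<in> R} \<inter> h ` A = B"
    proof
      show "{R \<in> X. p \<in> R} \<inter> h ` A \<subseteq> B"
      proof
        fix R assume "R \<in> {R \<in> X. p \<in> R} \<inter> h ` A"
        then obtain i where i: "i \<in> A" "R = h i" "p \<in> h i" by auto
        then have "i \<in> index_trace I h p \<inter> A" using AI by (auto simp: index_trace_def)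
        then show "R \<in> B" using p(2) i(2) by simp
      qed
      show "B \<subseteq> {R \<in> X. p \<in> R} \<inter> h ` A"
      proof
        fix R assume "R \<in> B"
        then obtain i where i: "i \<in> A" "R = h i" "h i \<in> B" using B by blast
        then have "i \<in> index_trace I h p" using p(2) by blast
        then show "R \<in> {R \<in> X. p \<in> R} \<inter> h ` A"
          using i AI h by (auto simp: index_trace_def)
      qed
    qed
    then show "\<exists>Y\<in>dual_family X V. Y \<inter> h ` A = B"
      using p(1) unfolding dual_family_def by blast
  qed
  then have "card (h ` A) < k" using vc A(1) unfolding vc_less_def by blast
  then show "card A < k" using card_image[OF inj] by simp
qed

text \<open>
  Fubini for product weights: the entry of index \<open>i\<close> is drawn last.
\<close>

lemma sum_PiE_split:
  assumes "i \<notin> I" "finite I" "finite X"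
  shows "(\<Sum>h\<in>PiE (insert i I) (\<lambda>_. X). sample_weight w (insert i I) h * f h)
    = (\<Sum>g\<in>PiE I (\<lambda>_. X). sample_weight w I g * (\<Sum>R\<in>X. w R * f (g(i := R))))"
proof -
  have "(\<Sum>h\<in>PiE (insert i I) (\<lambda>_. X). sample_weight w (insert i I) h * f h)
    = (\<Sum>(R, g)\<in>X \<times> PiE I (\<lambda>_. X). sample_weight w (insert i I) (g(i := R)) * f (g(i := R)))"
    unfolding PiE_insert_eq
    by (subst sum.reindex[OF inj_combinator[OF assms(1)]]) (auto intro!: sum.cong)
  also have "\<dots> = (\<Sum>(R, g)\<in>X \<times> PiE I (\<lambda>_. X). sample_weight w I g * (w R * f (g(i := R))))"
  proof (intro sum.cong refl, clarify)
    fix R g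
    have "(\<Prod>j\<in>I. w ((g(i := R)) j)) = (\<Prod>j\<in>I. w (g j))"
      using assms(1) by (intro prod.cong) auto
    then show "sample_weight w (insert i I) (g(i := R)) * f (g(i := R))
        = sample_weight w I g * (w R * f (g(i := R)))"
      using assms by (simp add: sample_weight_def)
  qed
  also have "\<dots> = (\<Sum>R\<in>X. \<Sum>g\<in>PiE I (\<lambda>_. X). sample_weight w I g * (w R * f (g(i := R))))"
    by (simp add: sum.cartesian_product)
  finally show ?thesis by (subst (asm) sum.swap) (simp add: sum_distrib_left)
qed

lemma sum_sample_weight:
  assumes "finite I" "finite X" "sum w X = 1"
  shows "(\<Sum>h\<in>PiE I (\<lambda>_. X). sample_weight w I h) = 1"
  using prod_sum_PiE[of I "\<lambda>_. X" "\<lambda>_. w"] assms by (simp add: sample_weight_def)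

text \<open>
  Fix all entries of the sample but the one of index \<open>i\<close>. They divide \<open>V\<close> into at most
  \<open>(card I + 1) ^ d\<close> classes, and the edges of direction \<open>i\<close> record how the last range splits the
  classes. A class of \<open>b\<close> points contributes at least \<open>\<delta> / 2 * (b - 1)\<close> in expectation.
\<close>

lemma expected_direction_weight_ge:
  assumes fV: "finite V" and fX: "finite X" and w: "\<And>R. R \<in> X \<Longrightarrow> 0 \<le> w R" and w1: "sum w X = 1"
    and fI: "finite I" and i: "i \<notin> I" and d0: "0 \<le> \<delta>"
    and sep: "\<And>x y. x \<in> V \<Longrightarrow> y \<in> V \<Longrightarrow> x \<noteq> y \<Longrightarrow> \<delta> \<le> separating_weight X w x y"
    and vc: "vc_less (dual_family X V) (Suc d)"
  shows "\<delta> / 2 * (real (card V) - (real (card I) + 1) ^ d)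
    \<le> (\<Sum>h\<in>PiE (insert i I) (\<lambda>_. X). sample_weight w (insert i I) h *
        real (\<Sum>B\<in>Pow I. min (fibre_size V (insert i I) h B) (fibre_size V (insert i I) h (insert i B))))"
    (is "?l \<le> ?r")
proof -
  define F where "F g R = real (\<Sum>B\<in>Pow I. min (fibre_size V (insert i I) (g(i := R)) B)
      (fibre_size V (insert i I) (g(i := R)) (insert i B)))" for g R
  have inner: "?l \<le> (\<Sum>R\<in>X. w R * F g R)" if g: "g \<in> PiE I (\<lambda>_. X)" for g
  proof -
    define Q where "Q B = {p \<in> V. index_trace I g p = B}" for B
    have tr: "index_trace (insert i I) (g(i := R)) p = (if p \<in> R then insert i (index_trace I g p) else index_trace I g p)"
      for R p
      using i by (auto simp: index_trace_def)
    have ni: "i \<notin> index_trace I g p" for p using i by (simp add: index_trace_def)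
    have fib: "fibre_size V (insert i I) (g(i := R)) B = card {p \<in> Q B. p \<notin> R}"
         "fibre_size V (insert i I) (g(i := R)) (insert i B) = card {p \<in> Q B. p \<in> R}"
      if "B \<subseteq> I" for B R
    proof -
      have iB: "i \<notin> B" using that i by blast
      show "fibre_size V (insert i I) (g(i := R)) B = card {p \<in> Q B. p \<notin> R}"
        unfolding fibre_size_def tr Q_def using iB by (intro arg_cong[where f = card]) auto
      show "fibre_size V (insert i I) (g(i := R)) (insert i B) = card {p \<in> Q B. p \<in> R}"
      proof -
        have "index_trace I g p \<noteq> insert i B" for p using ni[of p] by auto
        then show ?thesis
          unfolding fibre_size_def tr Q_def using insert_ident[OF ni iB]
          by (intro arg_cong[where f = card]) auto
      qed
    qed
    have vcg: "vc_less (index_trace I g ` V) (Suc d)"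
      using g by (intro vc_less_index_traces[OF vc fX]) auto
    have sub: "index_trace I g ` V \<subseteq> Pow I" by (auto simp: index_trace_def)
    have "card (index_trace I g ` V) \<le> (card I + 1) ^ d"
      by (rule card_le_of_vc_less[OF fI sub vcg])
    then have "real (card (index_trace I g ` V)) \<le> (real (card I) + 1) ^ d"
      by (metis (mono_tags, lifting) of_nat_1 of_nat_add of_nat_le_iff of_nat_power)
    then have "?l \<le> \<delta> / 2 * (real (card V) - real (card (index_trace I g ` V)))"
      using d0 by (intro mult_left_mono) auto
    also have "\<delta> / 2 * (real (card V) - real (card (index_trace I g ` V)))
        = (\<Sum>B\<in>index_trace I g ` V. \<delta> / 2 * (real (card (Q B)) - 1))"
    proof -
      have "real (card V) = (\<Sum>B\<in>index_trace I g ` V. real (card (Q B)))"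
        using sum.image_gen[OF fV, of "\<lambda>_. 1::real" "index_trace I g"] by (simp add: Q_def)
      then show ?thesis by (simp only: sum_distrib_left[symmetric] sum_subtractf) simp
    qed
    also have "\<dots> \<le> (\<Sum>B\<in>index_trace I g ` V. \<Sum>R\<in>X. w R *
        real (min (card {p \<in> Q B. p \<notin> R}) (card {p \<in> Q B. p \<in> R})))"
      by (intro sum_mono expected_min_split_ge w sep) (use fV in \<open>auto simp: Q_def\<close>)
    also have "\<dots> \<le> (\<Sum>B\<in>Pow I. \<Sum>R\<in>X. w R *
        real (min (card {p \<in> Q B. p \<notin> R}) (card {p \<in> Q B. p \<in> R})))"
      using fI sub w by (intro sum_mono2 sum_nonneg mult_nonneg_nonneg) auto
    also have "\<dots> = (\<Sum>R\<in>X. w R * F g R)"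
      unfolding F_def by (subst sum.swap) (auto simp: fib sum_distrib_left intro!: sum.cong)
    finally show ?thesis .
  qed
  have "?l = (\<Sum>g\<in>PiE I (\<lambda>_. X). sample_weight w I g * ?l)"
    by (simp only: sum_distrib_right[symmetric] sum_sample_weight[OF fI fX w1] mult_1_left)
  also have "\<dots> \<le> (\<Sum>g\<in>PiE I (\<lambda>_. X). sample_weight w I g * (\<Sum>R\<in>X. w R * F g R))"
    by (intro sum_mono mult_left_mono inner)
       (use w in \<open>auto simp: sample_weight_def intro!: prod_nonneg\<close>)
  also have "\<dots> = ?r"
    by (simp add: sum_PiE_split[OF i fI fX] F_def)
  finally show ?thesis .
qed

text \<open>
  The expected total weight of the unit distance graph of the traces, estimated in two ways: direction
  by direction from below, and by the weighted edge bound from above.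
\<close>

lemma separated_sample_bound:
  assumes fV: "finite V" and fX: "finite X" and w: "\<And>R. R \<in> X \<Longrightarrow> 0 \<le> w R" and w1: "sum w X = 1"
    and d0: "0 \<le> \<delta>"
    and sep: "\<And>x y. x \<in> V \<Longrightarrow> y \<in> V \<Longrightarrow> x \<noteq> y \<Longrightarrow> \<delta> \<le> separating_weight X w x y"
    and vc: "vc_less (dual_family X V) (Suc d)"
  shows "real s * (\<delta> / 2 * (real (card V) - real s ^ d)) \<le> real (Suc d) * real (card V)"
proof -
  define I where "I = {..<s}"
  have fI: "finite I" by (simp add: I_def)
  define D where "D h i = real (\<Sum>B\<in>Pow (I - {i}).
      min (fibre_size V I h B) (fibre_size V I h (insert i B)))" for h i
  have lower: "\<delta> / 2 * (real (card V) - real s ^ d) \<le> (\<Sum>h\<in>PiE I (\<lambda>_. X). sample_weight w I h * D h i)"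
    if "i \<in> I" for i
  proof -
    have "insert i (I - {i}) = I" and c: "real (card (I - {i})) + 1 = real s"
      using that by (auto simp: I_def)
    then show ?thesis
      using expected_direction_weight_ge[OF fV fX w w1 _ _ d0 sep vc, of "I - {i}" i] fI
      unfolding D_def by simp
  qed
  have upper: "(\<Sum>i\<in>I. D h i) \<le> real (Suc d) * real (card V)" if "h \<in> PiE I (\<lambda>_. X)" for h
  proof -
    have "(\<Sum>i\<in>I. \<Sum>B\<in>Pow (I - {i}). min (fibre_size V I h B) (fibre_size V I h (insert i B)))
        \<le> Suc d * card V"
      unfolding fibre_size_def
      by (intro sum_min_fibres_le fV fI vc_less_index_traces[OF vc fX]) (use that in \<open>auto simp: index_trace_def\<close>)
    then have "real (\<Sum>i\<in>I. \<Sum>B\<in>Pow (I - {i}). min (fibre_size V I h B) (fibre_size V I h (insert i B)))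
        \<le> real (Suc d * card V)"
      by (rule of_nat_mono)
    then show ?thesis unfolding D_def by (simp only: of_nat_sum of_nat_mult)
  qed
  have "real s * (\<delta> / 2 * (real (card V) - real s ^ d)) = (\<Sum>i\<in>I. \<delta> / 2 * (real (card V) - real s ^ d))"
    by (simp add: I_def)
  also have "\<dots> \<le> (\<Sum>i\<in>I. \<Sum>h\<in>PiE I (\<lambda>_. X). sample_weight w I h * D h i)"
    by (intro sum_mono lower)
  also have "\<dots> = (\<Sum>h\<in>PiE I (\<lambda>_. X). sample_weight w I h * (\<Sum>i\<in>I. D h i))"
    by (subst sum.swap) (simp add: sum_distrib_left)
  also have "\<dots> \<le> (\<Sum>h\<in>PiE I (\<lambda>_. X). sample_weight w I h * (real (Suc d) * real (card V)))"
    by (intro sum_mono mult_left_mono upper)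
       (use w in \<open>auto simp: sample_weight_def intro!: prod_nonneg\<close>)
  also have "\<dots> = real (Suc d) * real (card V)"
    by (simp only: sum_distrib_right[symmetric] sum_sample_weight[OF fI fX w1] mult_1_left)
  finally show ?thesis .
qed

text \<open>
  Haussler's packing lemma. The sample size \<open>s\<close> is of order \<open>1 / \<delta>\<close>, with a constant for which the two
  estimates give \<open>2 * (card V - s ^ d) \<le> card V\<close>.
\<close>

lemma card_le_of_separated:
  assumes fV: "finite V" and fX: "finite X" and w: "\<And>R. R \<in> X \<Longrightarrow> 0 \<le> w R" and w1: "sum w X = 1"
    and d0: "0 < \<delta>" and d1: "\<delta> \<le> 1"
    and sep: "\<And>x y. x \<in> V \<Longrightarrow> y \<in> V \<Longrightarrow> x \<noteq> y \<Longrightarrow> \<delta> \<le> separating_weight X w x y"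
    and vc: "vc_less (dual_family X V) (Suc d)"
  shows "real (card V) \<le> 2 * (5 * real (Suc d) / \<delta>) ^ d"
proof -
  define s where "s = nat \<lceil>4 * real (Suc d) / \<delta>\<rceil>"
  have s: "4 * real (Suc d) / \<delta> \<le> real s"
    unfolding s_def by linarith
  define q where "q = real (Suc d) / \<delta>"
  have "real s \<le> 4 * q + 1"
    unfolding s_def q_def times_divide_eq_right using d0 by (simp del: of_nat_Suc)
  moreover have "1 \<le> q" using d0 d1 by (simp add: q_def field_simps)
  ultimately have "real s \<le> 5 * q" by simp
  then have s': "real s \<le> 5 * real (Suc d) / \<delta>"
    by (simp only: q_def times_divide_eq_right)
  define k where "k = real (card V) - real s ^ d"
  have main: "real s * (\<delta> / 2 * k) \<le> real (Suc d) * real (card V)"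
    unfolding k_def by (rule separated_sample_bound[OF fV fX w w1 _ sep vc]) (use d0 in auto)
  have "2 * k \<le> real (card V)"
  proof (cases "k \<ge> 0")
    case True
    define c where "c = real (Suc d)"
    have "4 * c \<le> real s * \<delta>" using s d0 by (simp only: c_def pos_divide_le_eq)
    then have "4 * c * (k / 2) \<le> real s * \<delta> * (k / 2)"
      using True by (intro mult_right_mono) auto
    also have "\<dots> = real s * (\<delta> / 2 * k)" by simp
    also have "\<dots> \<le> c * real (card V)" using main by (simp only: c_def)
    finally have "c * (2 * k) \<le> c * real (card V)" by (simp add: algebra_simps)
    then show ?thesis by (rule mult_left_le_imp_le) (simp add: c_def)
  qed auto
  then have "real (card V) \<le> 2 * real s ^ d" by (simp add: k_def)
  also have "\<dots> \<le> 2 * (5 * real (Suc d) / \<delta>) ^ d"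
    using s' by (intro mult_left_mono power_mono) auto
  finally show ?thesis .
qed

text \<open>
  If all pairs were separated by a larger share of the total weight, the packing lemma would allow
  fewer than \<open>card V\<close> points. The exponent \<open>- 1 / d\<close> is the inverse of the packing exponent.
\<close>

lemma exists_rarely_separated_pair:
  assumes fV: "finite V" and V2: "2 \<le> card V" and fX: "finite X" and w: "\<And>R. R \<in> X \<Longrightarrow> 0 \<le> w R"
    and vc: "vc_less (dual_family X V) (Suc d)" and d: "0 < d"
  obtains x y where "x \<in> V" "y \<in> V" "x \<noteq> y"
    "separating_weight X w x y \<le> 20 * real (Suc d) * real (card V) powr (- 1 / real d) * sum w X"
proof -
  define \<delta> where "\<delta> = 20 * real (Suc d) * real (card V) powr (- 1 / real d)"
  define W where "W = sum w X"
  have d0: "0 < \<delta>" using V2 by (auto simp: \<delta>_def)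
  have W0: "0 \<le> W" using w by (simp add: W_def sum_nonneg)
  have le_W: "separating_weight X w x y \<le> W" for x y
    unfolding separating_weight_def W_def using w by (intro sum_mono) auto
  obtain x0 y0 where xy0: "x0 \<in> V" "y0 \<in> V" "x0 \<noteq> y0"
    using V2 fV by (metis card_le_Suc0_iff_eq not_less_eq_eq numeral_2_eq_2)
  have "\<exists>x\<in>V. \<exists>y\<in>V. x \<noteq> y \<and> separating_weight X w x y \<le> \<delta> * W"
  proof (rule ccontr)
    assume neg: "\<not> ?thesis"
    then have big: "\<delta> * W < separating_weight X w x y" if "x \<in> V" "y \<in> V" "x \<noteq> y" for x y
      using that by force
    have "\<delta> * W < W" using big[OF xy0] le_W[of x0 y0] by simp
    then have W: "0 < W" using W0 by (cases "W = 0") auto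
    then have d1: "\<delta> < 1" using \<open>\<delta> * W < W\<close> by simp
    define w' where "w' R = w R / W" for R
    have sep': "separating_weight X w' x y = separating_weight X w x y / W" for x y
      unfolding separating_weight_def w'_def by (auto simp: sum_divide_distrib intro!: sum.cong)
    have "real (card V) \<le> 2 * (5 * real (Suc d) / \<delta>) ^ d"
    proof (rule card_le_of_separated[OF fV fX _ _ d0 _ _ vc])
      show "sum w' X = 1" using W by (simp add: w'_def W_def flip: sum_divide_distrib)
      show "\<delta> \<le> separating_weight X w' x y" if "x \<in> V" "y \<in> V" "x \<noteq> y" for x y
        using big[OF that] W by (simp add: sep' field_simps)
    qed (use w W d1 in \<open>auto simp: w'_def\<close>)
    \<comment> \<open>The constant 20 exceeds the 5 of the packing lemma by a factor 4 that outweighs its factor 2.\<close>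
    also have "5 * real (Suc d) / \<delta> = real (card V) powr (1 / real d) / 4"
      using V2 by (simp add: \<delta>_def powr_minus field_simps)
    also have "2 * \<dots> ^ d = 2 * real (card V) / 4 ^ d"
      using V2 d by (simp add: power_divide powr_powr flip: powr_realpow)
    also have "\<dots> \<le> 2 * real (card V) / 4 ^ 1"
      using d by (intro divide_left_mono power_increasing) auto
    finally show False using V2 by simp
  qed
  then show thesis using that unfolding \<delta>_def W_def by blast
qed

section \<open>Partitions of a finite point set by hyperplanes\<close>

lemma exists_linear_dependence:
  fixes v :: "'i \<Rightarrow> 'a::euclidean_space"
  assumes fI: "finite I" and c: "DIM('a) < card I"
  obtains u where "\<exists>i\<in>I. u i \<noteq> 0" "(\<Sum>i\<in>I. u i *\<^sub>R v i) = 0"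
proof (cases "inj_on v I")
  case True
  have "dependent (v ` I)"
    using c by (intro dependent_biggerset) (simp add: card_image[OF True])
  then obtain u where u: "\<exists>x\<in>v ` I. u x \<noteq> 0" "(\<Sum>x\<in>v ` I. u x *\<^sub>R x) = 0"
    using dependent_finite[of "v ` I"] fI by auto
  show thesis
    by (rule that[of "u \<circ> v"]) (use u True in \<open>auto simp: sum.reindex\<close>)
next
  case False
  then obtain i j where ij: "i \<in> I" "j \<in> I" "i \<noteq> j" "v i = v j" by (auto simp: inj_on_def)
  define u where "u k = (if k = i then 1 else 0) - (if k = j then 1 else 0 :: real)" for k
  have "(\<Sum>k\<in>I. u k *\<^sub>R v k)
      = (\<Sum>k\<in>I. if k = i then v k else 0) - (\<Sum>k\<in>I. if k = j then v k else 0)"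
    unfolding sum_subtractf[symmetric] by (intro sum.cong) (auto simp: u_def)
  then have "(\<Sum>k\<in>I. u k *\<^sub>R v k) = 0" using ij fI by simp
  moreover have "u i \<noteq> 0" using ij by (simp add: u_def)
  ultimately show thesis using that ij by blast
qed

text \<open>
  The functions \<open>\<lambda>x. v i \<bullet> x - c i\<close> have a nontrivial linear combination that is constant when there
  are more of them than the dimension. At a point where all signs agree with those of the coefficients
  this constant is positive, at a point with all signs reversed it is negative.
\<close>

lemma not_all_sign_patterns:
  fixes v :: "'i \<Rightarrow> 'a::euclidean_space" and c :: "'i \<Rightarrow> real"
  assumes fI: "finite I" and pat: "\<And>J. J \<subseteq> I \<Longrightarrow>
    \<exists>x. \<forall>i\<in>I. if i \<in> J then c i < v i \<bullet> x else v i \<bullet> x < c i"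
  shows "card I \<le> DIM('a)"
proof (rule ccontr)
  assume "\<not> ?thesis"
  then obtain u where u: "\<exists>i\<in>I. u i \<noteq> 0" "(\<Sum>i\<in>I. u i *\<^sub>R v i) = 0"
    using exists_linear_dependence[OF fI, where v = v] by (metis not_le)
  have eq: "(\<Sum>i\<in>I. u i * (v i \<bullet> x - c i)) = - (\<Sum>i\<in>I. u i * c i)" for x
  proof -
    have "(\<Sum>i\<in>I. u i * (v i \<bullet> x)) = (\<Sum>i\<in>I. u i *\<^sub>R v i) \<bullet> x"
      by (simp add: inner_sum_left)
    then show ?thesis using u(2) by (simp add: right_diff_distrib sum_subtractf)
  qed
  obtain x where x: "\<forall>i\<in>I. if i \<in> {i \<in> I. 0 < u i} then c i < v i \<bullet> x else v i \<bullet> x < c i"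
    using pat[of "{i \<in> I. 0 < u i}"] by auto
  obtain y where y: "\<forall>i\<in>I. if i \<in> {i \<in> I. u i < 0} then c i < v i \<bullet> y else v i \<bullet> y < c i"
    using pat[of "{i \<in> I. u i < 0}"] by auto
  obtain k where k: "k \<in> I" "u k \<noteq> 0" using u(1) by blast
  have "0 < (\<Sum>i\<in>I. u i * (v i \<bullet> x - c i))"
  proof (rule sum_pos2[OF fI k(1)])
    show "0 < u k * (v k \<bullet> x - c k)"
      using x k by (cases "0 < u k") (auto intro: mult_pos_pos mult_neg_neg)
    show "0 \<le> u i * (v i \<bullet> x - c i)" if "i \<in> I" for i
      using x that
      by (cases "0 < u i") (auto simp: zero_le_mult_iff intro: less_imp_le)
  qed
  moreover have "0 < (\<Sum>i\<in>I. - (u i * (v i \<bullet> y - c i)))"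
  proof (rule sum_pos2[OF fI k(1)])
    show "0 < - (u k * (v k \<bullet> y - c k))"
      using y k by (cases "u k < 0") (auto intro: mult_pos_neg mult_neg_pos)
    show "0 \<le> - (u i * (v i \<bullet> y - c i))" if "i \<in> I" for i
      using y that
      by (cases "u i < 0") (auto simp: mult_le_0_iff intro: less_imp_le)
  qed
  ultimately show False by (simp add: eq sum_negf)
qed

text \<open>
  The partitions of \<open>P\<close> by hyperplanes avoiding \<open>P\<close>, each given by the part on one side. Replacing
  hyperplanes by these sets makes the collection finite.
\<close>

definition halfspace_cuts :: "'a::euclidean_space set \<Rightarrow> 'a set set" where
  "halfspace_cuts P = {P \<inter> {x. b < a \<bullet> x} | a b. \<forall>p\<in>P. a \<bullet> p \<noteq> b}"

text \<open>
  A hyperplane is the vector \<open>(a, - b)\<close>, and a point \<open>p\<close> is the linear functional \<open>(p, 1)\<close> on these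
  vectors; there are at most \<open>d + 1\<close> points whose signs are independent.
\<close>

lemma vc_less_halfspace_cuts:
  fixes P :: "'a::euclidean_space set"
  shows "vc_less (halfspace_cuts P) (DIM('a) + 2)"
  unfolding vc_less_def
proof (intro allI impI)
  fix A assume A: "finite A" "shatters (halfspace_cuts P) A"
  have AP: "A \<subseteq> P"
    using A(2) unfolding shatters_def halfspace_cuts_def by blast
  have "card A \<le> DIM('a \<times> real)"
  proof (rule not_all_sign_patterns[where c = "\<lambda>_. 0" and v = "\<lambda>p. (p, 1)", OF A(1)])
    fix J assume "J \<subseteq> A"
    then obtain a b where ab: "\<forall>p\<in>P. a \<bullet> p \<noteq> b" "P \<inter> {x. b < a \<bullet> x} \<inter> A = J"
      using A(2) unfolding shatters_def halfspace_cuts_def by blast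
    have "if p \<in> J then 0 < (p, 1) \<bullet> (a, - b) else (p, 1) \<bullet> (a, - b) < 0" if "p \<in> A" for p
    proof -
      have "a \<bullet> p \<noteq> b" "p \<in> J \<longleftrightarrow> b < a \<bullet> p" using ab AP that by auto
      then show ?thesis by (auto simp: inner_commute)
    qed
    then have "\<forall>p\<in>A. if p \<in> J then 0 < (p, 1) \<bullet> (a, - b) else (p, 1) \<bullet> (a, - b) < 0"
      by blast
    then show "\<exists>x. \<forall>p\<in>A. if p \<in> J then 0 < (p, 1 :: real) \<bullet> x else (p, 1 :: real) \<bullet> x < 0"
      by (rule exI[of _ "(a, - b)"])
  qed
  then show "card A < DIM('a) + 2" by simp
qed

text \<open>
  Here hyperplanes act as affine functions on points. The dimension \<open>d\<close>, one less than in the primal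
  bound, is what makes the exponent of the final estimate \<open>1 - 1 / d\<close>.
\<close>

lemma vc_less_dual_halfspace_cuts:
  fixes P :: "'a::euclidean_space set"
  assumes "V \<subseteq> P"
  shows "vc_less (dual_family (halfspace_cuts P) V) (Suc DIM('a))"
  unfolding vc_less_def
proof (intro allI impI)
  fix A assume A: "finite A" "shatters (dual_family (halfspace_cuts P) V) A"
  have sh: "\<exists>p\<in>V. {R \<in> halfspace_cuts P. p \<in> R} \<inter> A = B" if "B \<subseteq> A" for B
    using A(2) that unfolding shatters_def dual_family_def by blast
  have "A \<subseteq> halfspace_cuts P" using sh[of A] by blast
  then have "\<forall>R\<in>A. \<exists>a b. (\<forall>p\<in>P. a \<bullet> p \<noteq> b) \<and> R = P \<inter> {x. b < a \<bullet> x}"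
    unfolding halfspace_cuts_def by blast
  then obtain a b where ab: "\<And>R. R \<in> A \<Longrightarrow> (\<forall>p\<in>P. a R \<bullet> p \<noteq> b R) \<and> R = P \<inter> {x. b R < a R \<bullet> x}"
    by metis
  have "card A \<le> DIM('a)"
  proof (rule not_all_sign_patterns[where c = b and v = a, OF A(1)])
    fix J assume "J \<subseteq> A"
    then obtain p where p: "p \<in> V" "{R \<in> halfspace_cuts P. p \<in> R} \<inter> A = J" using sh by blast
    have "if R \<in> J then b R < a R \<bullet> p else a R \<bullet> p < b R" if "R \<in> A" for R
    proof -
      have "R \<in> J \<longleftrightarrow> p \<in> R" using p(2) that \<open>A \<subseteq> halfspace_cuts P\<close> by blast
      moreover have "p \<in> R \<longleftrightarrow> b R < a R \<bullet> p" using ab[OF that] p(1) assms by blast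
      moreover have "a R \<bullet> p \<noteq> b R" using ab[OF that] p(1) assms by blast
      ultimately show ?thesis by auto
    qed
    then show "\<exists>x. \<forall>R\<in>A. if R \<in> J then b R < a R \<bullet> x else a R \<bullet> x < b R" by blast
  qed
  then show "card A < Suc DIM('a)" by simp
qed

lemma card_halfspace_cuts_le:
  fixes P :: "'a::euclidean_space set"
  assumes "finite P"
  shows "card (halfspace_cuts P) \<le> (card P + 1) ^ (DIM('a) + 1)"
  by (rule card_le_of_vc_less[OF assms])
     (use vc_less_halfspace_cuts[of P] in \<open>auto simp: halfspace_cuts_def\<close>)

section \<open>Trees grown by attaching leaves\<close>

text \<open>
  Every edge \<open>(x, y)\<close> is oriented from the leaf \<open>x\<close> to the vertex \<open>y\<close> to which it is attached.
\<close>

inductive leaf_tree :: "'a set \<Rightarrow> ('a \<times> 'a) set \<Rightarrow> bool" where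
  root: "leaf_tree {x} {}"
| leaf: "leaf_tree V E \<Longrightarrow> y \<in> V \<Longrightarrow> x \<notin> V \<Longrightarrow> leaf_tree (insert x V) (insert (x, y) E)"

definition leaf_tree_graph :: "'a set \<Rightarrow> ('a \<times> 'a) set \<Rightarrow> 'a pair_pre_digraph" where
  "leaf_tree_graph V E = \<lparr> pverts = V, parcs = E \<union> E\<inverse> \<rparr>"

lemma leaf_tree_edges: "leaf_tree V E \<Longrightarrow> E \<subseteq> V \<times> V"
  by (induction rule: leaf_tree.induct) auto

lemma leaf_tree_finite: "leaf_tree V E \<Longrightarrow> finite V \<and> finite E"
  by (induction rule: leaf_tree.induct) auto

lemma leaf_tree_loopfree: "leaf_tree V E \<Longrightarrow> (x, x) \<notin> E"
  by (induction rule: leaf_tree.induct) auto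

lemma leaf_tree_pair_graph:
  assumes "leaf_tree V E"
  shows "pair_graph (leaf_tree_graph V E)"
proof
  show "symmetric (with_proj (leaf_tree_graph V E))"
    by (auto simp: symmetric_def leaf_tree_graph_def arcs_ends_def arc_to_ends_def sym_def image_iff)
qed (use leaf_tree_edges[OF assms] leaf_tree_finite[OF assms] leaf_tree_loopfree[OF assms] in
      \<open>auto simp: leaf_tree_graph_def\<close>)

lemma leaf_tree_reachable:
  assumes "leaf_tree V E" "u \<in> V" "v \<in> V"
  shows "(u, v) \<in> rtrancl_on V (E \<union> E\<inverse>)"
  using assms
proof (induction arbitrary: u v rule: leaf_tree.induct)
  case (root x)
  then show ?case by (simp add: rtrancl_on_refl)
next
  case (leaf V E y x)
  let ?r = "rtrancl_on (insert x V) (insert (x, y) E \<union> (insert (x, y) E)\<inverse>)"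
  have old: "(a, b) \<in> ?r" if "a \<in> V" "b \<in> V" for a b
    by (rule rtrancl_on_mono[OF _ _ leaf.IH[OF that]]) auto
  have xy: "(x, y) \<in> ?r" "(y, x) \<in> ?r"
    using leaf.hyps by (auto intro: rtrancl_on_into_rtrancl_on rtrancl_on_refl)
  have to_y: "(u, y) \<in> ?r" and from_y: "(y, v) \<in> ?r"
    using leaf.prems leaf.hyps old xy by auto
  show ?case using rtrancl_on_trans[OF to_y from_y] .
qed

text \<open>
  A walk in terms of the lists of its tails and heads, which makes the cyclic structure of a closed
  walk accessible: the two lists differ by a rotation.
\<close>

lemma cas_with_proj_verts:
  assumes "pre_digraph.cas (with_proj G) u p v"
  shows "pre_digraph.awalk_verts (with_proj G) u p = u # map snd p"
    and "map fst p @ [v] = u # map snd p"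
    and "Suc j < length p \<Longrightarrow> snd (p ! j) = fst (p ! Suc j)"
proof -
  show v1: "pre_digraph.awalk_verts (with_proj G) u p = u # map snd p"
    using assms by (induction p arbitrary: u)
      (auto simp: pre_digraph.awalk_verts.simps pre_digraph.cas.simps simp del: awalk_verts_with_proj_eq cas_with_proj_eq)
  show v2: "map fst p @ [v] = u # map snd p"
    using assms by (induction p arbitrary: u)
      (auto simp: pre_digraph.cas.simps simp del: cas_with_proj_eq)
  show "snd (p ! j) = fst (p ! Suc j)" if "Suc j < length p"
    using arg_cong[OF v2, of "\<lambda>l. l ! Suc j"] that by (simp add: nth_append)
qed

text \<open>
  A cycle that enters the newest leaf \<open>x\<close> does so from its only neighbour \<open>y\<close> and returns to \<open>y\<close> at once,
  so it has length 2. A cycle that avoids \<open>x\<close> lies in the smaller tree.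
\<close>

lemma leaf_tree_acyclic:
  assumes "leaf_tree V E"
  shows "\<not> (pre_digraph.cycle (with_proj (leaf_tree_graph V E)) p \<and> 3 \<le> length p)"
  using assms
proof (induction rule: leaf_tree.induct)
  case (root x)
  show ?case by (auto simp: pre_digraph.cycle_def pre_digraph.awalk_def leaf_tree_graph_def)
next
  case (leaf V E y x)
  let ?G = "with_proj (leaf_tree_graph (insert x V) (insert (x, y) E))"
  show ?case
  proof
    assume asm: "pre_digraph.cycle ?G p \<and> 3 \<le> length p"
    then obtain u where u: "u \<in> insert x V" "set p \<subseteq> insert (x, y) E \<union> (insert (x, y) E)\<inverse>"
      "pre_digraph.cas ?G u p u" "distinct (tl (pre_digraph.awalk_verts ?G u p))"
      by (auto simp: pre_digraph.cycle_def pre_digraph.awalk_def leaf_tree_graph_def)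
    have n: "3 \<le> length p" and "p \<noteq> []" using asm by auto
    note walk = cas_with_proj_verts[OF u(3)]
    have dist_snd: "distinct (map snd p)" using u(4) by (simp add: walk(1))
    have "mset (map fst p) = mset (map snd p)"
      using arg_cong[OF walk(2), of mset] by simp
    then have dist_fst: "distinct (map fst p)" and same: "set (map fst p) = set (map snd p)"
      using dist_snd mset_eq_imp_distinct_iff mset_eq_setD by blast+
    have succ: "snd (p ! j) = fst (p ! (Suc j mod length p))" if "j < length p" for j
    proof (cases "Suc j < length p")
      case True
      then show ?thesis using walk(3) by simp
    next
      case False
      then have j: "Suc j = length p" using that by simp
      have "snd (p ! j) = u"
        using arg_cong[OF walk(2), of last] \<open>p \<noteq> []\<close>
        by (simp add: last_map last_conv_nth eq_diff_iff flip: j split: if_splits)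
      moreover have "fst (p ! 0) = u"
        using arg_cong[OF walk(2), of hd] n by (cases p) auto
      ultimately show ?thesis using j by simp
    qed
    have new: "e = (x, y) \<or> e = (y, x)" if "e \<in> set p" "fst e = x \<or> snd e = x" for e
    proof -
      have "e \<in> insert (x, y) E \<union> (insert (x, y) E)\<inverse>" using that(1) u(2) by blast
      then show ?thesis
        using that(2) leaf_tree_edges[OF leaf.hyps(1)] leaf.hyps(3) by (cases e) auto
    qed
    have xy: "x \<noteq> y" using leaf.hyps by auto
    show False
    proof (cases "x \<in> set (map snd p)")
      case True
      then obtain j where j: "j < length p" "snd (p ! j) = x" by (auto simp: in_set_conv_nth)
      \<comment> \<open>The arcs at positions \<open>j\<close>, \<open>j1\<close> are \<open>(y, x)\<close>, \<open>(x, y)\<close>; the next one starts at \<open>y\<close> again.\<close>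
      define j1 where "j1 = Suc j mod length p"
      define j2 where "j2 = Suc j1 mod length p"
      have lt: "j1 < length p" "j2 < length p"
        using mod_less_divisor[of "length p"] \<open>p \<noteq> []\<close> by (simp_all add: j1_def j2_def)
      have pj: "p ! j = (y, x)" using new[of "p ! j"] j xy by (metis nth_mem snd_conv)
      have "fst (p ! j1) = x" using succ[OF j(1)] j(2) by (simp add: j1_def)
      then have "p ! j1 = (x, y)" using new[of "p ! j1"] lt xy by (metis nth_mem fst_conv)
      then have "fst (p ! j2) = fst (p ! j)" using succ[OF lt(1)] pj by (simp add: j2_def)
      then have "j2 = j" using dist_fst lt(2) j(1) by (simp add: distinct_conv_nth) blast
      then show False using n j(1) unfolding j1_def j2_def by (auto simp: mod_Suc split: if_splits)
    next
      case False
      then have no_x: "fst e \<noteq> x \<and> snd e \<noteq> x" if "e \<in> set p" for e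
        using same that by (metis image_eqI list.set_map)
      have "set p \<subseteq> E \<union> E\<inverse>"
      proof
        fix e assume "e \<in> set p"
        then show "e \<in> E \<union> E\<inverse>" using u(2) no_x[of e] by auto
      qed
      moreover have "u \<in> V"
      proof -
        have "u = fst (hd p)" "hd p \<in> set p" using arg_cong[OF walk(2), of hd] n by (cases p; auto)+
        then show ?thesis using no_x u(1) by auto
      qed
      ultimately have "pre_digraph.cycle (with_proj (leaf_tree_graph V E)) p"
        using u(3,4) n unfolding pre_digraph.cycle_def pre_digraph.awalk_def
        by (auto simp: leaf_tree_graph_def cas_with_proj_eq awalk_verts_with_proj_eq)
      then show False using leaf.IH n by blast
    qed
  qed
qed

lemma geometric_spanning_tree_leaf_tree:
  assumes "leaf_tree V E"
  shows "geometric_spanning_tree V (leaf_tree_graph V E)"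
proof -
  let ?M = "mk_symmetric (with_proj (leaf_tree_graph V E))"
  have "arcs_ends (with_proj ?M) = E \<union> E\<inverse>"
    by (auto simp: mk_symmetric_def leaf_tree_graph_def arcs_ends_def arc_to_ends_def)
  moreover have "verts (with_proj ?M) = V"
    by (simp add: mk_symmetric_def leaf_tree_graph_def)
  moreover have "V \<noteq> {}" using assms by cases auto
  ultimately have "Digraph_Component.connected (with_proj (leaf_tree_graph V E))"
    using leaf_tree_reachable[OF assms]
    unfolding Digraph_Component.connected_def strongly_connected_def reachable_def by simp
  then show ?thesis
    using leaf_tree_pair_graph[OF assms] leaf_tree_acyclic[OF assms]
    by (simp add: geometric_spanning_tree_def undirected_tree_def leaf_tree_graph_def)
qed

definition separation_number :: "('a \<times> 'a) set \<Rightarrow> 'a set \<Rightarrow> nat" where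
  "separation_number E R = card {(x, y) \<in> E. (x \<in> R) \<noteq> (y \<in> R)}"

text \<open>
  A hyperplane that avoids \<open>P\<close> meets a segment between points of \<open>P\<close> only if it separates the end
  points, because open halfspaces are convex.
\<close>

lemma crossing_number_leaf_tree_le:
  fixes P :: "'a::euclidean_space set"
  assumes tree: "leaf_tree P E" and cr: "\<And>R. R \<in> halfspace_cuts P \<Longrightarrow> separation_number E R \<le> k"
  shows "crossing_number (leaf_tree_graph P E) \<le> k"
proof -
  let ?T = "leaf_tree_graph P E"
  interpret pair_graph ?T by (rule leaf_tree_pair_graph[OF tree])
  have "card (crossed_edges ?T H) \<le> k" if H: "is_hyperplane H" "H \<inter> pverts ?T = {}" for H
  proof -
    obtain a b where ab: "H = {x. a \<bullet> x = b}" using H(1) by (auto simp: is_hyperplane_def)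
    define R where "R = P \<inter> {x. b < a \<bullet> x}"
    define S where "S = {(x, y) \<in> E. (x \<in> R) \<noteq> (y \<in> R)}"
    have off: "a \<bullet> p \<noteq> b" if "p \<in> P" for p
      using H(2) that by (auto simp: ab leaf_tree_graph_def)
    have R: "R \<in> halfspace_cuts P"
      using off unfolding halfspace_cuts_def R_def by blast
    have sep: "(u \<in> R) \<noteq> (v \<in> R)" if uv: "u \<in> P" "v \<in> P" "closed_segment u v \<inter> H \<noteq> {}" for u v
    proof
      assume same: "(u \<in> R) = (v \<in> R)"
      show False
      proof (cases "u \<in> R")
        case True
        then have "closed_segment u v \<subseteq> {x. a \<bullet> x > b}"
          using same by (intro closed_segment_subset convex_halfspace_gt) (auto simp: R_def)
        then show False using uv(3) by (auto simp: ab)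
      next
        case False
        then have "closed_segment u v \<subseteq> {x. a \<bullet> x < b}"
          using same uv off[of u] off[of v]
          by (intro closed_segment_subset convex_halfspace_lt) (auto simp: R_def)
        then show False using uv(3) by (auto simp: ab)
      qed
    qed
    have fin: "finite S"
      using leaf_tree_finite[OF tree] by (auto simp: S_def intro: finite_subset[of _ E])
    have "crossed_edges ?T H \<subseteq> (\<lambda>(x, y). {x, y}) ` S"
    proof
      fix e assume "e \<in> crossed_edges ?T H"
      then obtain u v where uv: "e = {u, v}" "(u, v) \<in> E \<or> (v, u) \<in> E" "closed_segment u v \<inter> H \<noteq> {}"
        by (auto simp: crossed_edges_def leaf_tree_graph_def)
      then have "(u \<in> R) \<noteq> (v \<in> R)" using sep leaf_tree_edges[OF tree] by blast
      then have "(u, v) \<in> S \<or> (v, u) \<in> S" using uv(2) by (auto simp: S_def)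
      then show "e \<in> (\<lambda>(x, y). {x, y}) ` S" using uv(1) by (force simp: insert_commute)
    qed
    then have "card (crossed_edges ?T H) \<le> card S"
      using fin by (meson card_image_le card_mono finite_imageI order_trans)
    also have "\<dots> \<le> k" using cr[OF R] by (simp add: S_def separation_number_def)
    finally show ?thesis .
  qed
  then show ?thesis using crossing_number_le_iff[OF pair_fin_digraph_axioms] by blast
qed

section \<open>Iterative reweighting\<close>

lemma separation_number_insert:
  assumes "finite E" "(x, y) \<notin> E"
  shows "separation_number (insert (x, y) E) R
    = separation_number E R + (if (x \<in> R) \<noteq> (y \<in> R) then 1 else 0)"
proof -
  have "{(u, v) \<in> insert (x, y) E. (u \<in> R) \<noteq> (v \<in> R)}
      = (if (x \<in> R) \<noteq> (y \<in> R) then {(x, y)} else {}) \<union> {(u, v) \<in> E. (u \<in> R) \<noteq> (v \<in> R)}"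
    by auto
  moreover have "finite {(u, v) \<in> E. (u \<in> R) \<noteq> (v \<in> R)}"
    by (rule finite_subset[OF _ assms(1)]) auto
  ultimately show ?thesis using assms(2) by (simp add: separation_number_def)
qed

text \<open>
  The tree is grown backwards. A pair \<open>x\<close>, \<open>y\<close> separated by a small share of the total weight is joined,
  the weights of the separating ranges are doubled, which makes them expensive for all later edges, and
  \<open>x\<close> is discarded, to be attached to \<open>y\<close> as a leaf at the end. While \<open>i\<close> points remain, doubling raises the
  total weight by a factor of at most \<open>1 + O(i powr (- 1 / d))\<close>, and a range separating \<open>r\<close> edges has had
  its weight multiplied by \<open>2 ^ r\<close>.
\<close>

lemma reweighted_leaf_tree:
  assumes "finite V" "V \<noteq> {}" and fX: "finite X" and "\<And>R. R \<in> X \<Longrightarrow> 0 \<le> w R"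
    and "vc_less (dual_family X V) (Suc d)" and d: "0 < d"
  shows "\<exists>E. leaf_tree V E \<and> (\<Sum>R\<in>X. w R * 2 ^ separation_number E R)
    \<le> sum w X * (\<Prod>i=2..card V. 1 + 20 * real (Suc d) * real i powr (- 1 / real d))"
  using assms(1,2,4,5)
proof (induction "card V" arbitrary: V w)
  case 0
  then show ?case by simp
next
  case (Suc n)
  show ?case
  proof (cases "n = 0")
    case True
    then obtain x where "V = {x}" using Suc.hyps(2) by (metis One_nat_def card_1_singletonE)
    then show ?thesis
      by (intro exI[of _ "{}"]) (auto simp: leaf_tree.root separation_number_def)
  next
    case False
    define K where "K = 20 * real (Suc d) * real (card V) powr (- 1 / real d)"
    have "2 \<le> card V" using Suc.hyps(2) False by simp
    then obtain x y where xy: "x \<in> V" "y \<in> V" "x \<noteq> y" and sep: "separating_weight X w x y \<le> K * sum w X"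
      using exists_rarely_separated_pair[where w = w and X = X, OF Suc.prems(1) _ fX _ Suc.prems(4) d]
        Suc.prems(3)
      unfolding K_def by blast
    define w' where "w' R = w R * (if (x \<in> R) \<noteq> (y \<in> R) then 2 else 1)" for R
    have "sum w' X = sum w X + separating_weight X w x y"
      unfolding separating_weight_def sum.distrib[symmetric] by (intro sum.cong) (auto simp: w'_def)
    then have w'_le: "sum w' X \<le> sum w X * (1 + K)" using sep by (simp add: algebra_simps)
    have cV: "card (V - {x}) = n" "V - {x} \<noteq> {}" using Suc.hyps(2) Suc.prems(1) xy by auto
    have vc: "vc_less (dual_family X (V - {x})) (Suc d)"
      by (rule vc_less_mono[OF Suc.prems(4)]) (auto simp: dual_family_def)
    have "0 \<le> w' R" if "R \<in> X" for R using Suc.prems(3)[OF that] by (simp add: w'_def)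
    then obtain E where E: "leaf_tree (V - {x}) E" "(\<Sum>R\<in>X. w' R * 2 ^ separation_number E R)
        \<le> sum w' X * (\<Prod>i=2..n. 1 + 20 * real (Suc d) * real i powr (- 1 / real d))"
      using Suc.hyps(1)[of "V - {x}" w'] cV vc Suc.prems(1) by auto
    have nE: "(x, y) \<notin> E" using leaf_tree_edges[OF E(1)] by auto
    have tree: "leaf_tree V (insert (x, y) E)"
      using leaf_tree.leaf[OF E(1), of y x] xy by (simp add: insert_absorb)
    have "(\<Sum>R\<in>X. w R * 2 ^ separation_number (insert (x, y) E) R)
        = (\<Sum>R\<in>X. w' R * 2 ^ separation_number E R)"
      using leaf_tree_finite[OF E(1)] nE
      by (intro sum.cong) (auto simp: separation_number_insert w'_def)
    also have "\<dots> \<le> sum w' X * (\<Prod>i=2..n. 1 + 20 * real (Suc d) * real i powr (- 1 / real d))"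
      by (rule E(2))
    also have "\<dots> \<le> sum w X * (1 + K) * (\<Prod>i=2..n. 1 + 20 * real (Suc d) * real i powr (- 1 / real d))"
      by (intro mult_right_mono w'_le prod_nonneg) auto
    also have "\<dots> = sum w X * (\<Prod>i=2..card V. 1 + 20 * real (Suc d) * real i powr (- 1 / real d))"
    proof -
      have "{2..card V} = insert (card V) {2..n}" "card V \<notin> {2..n}"
        using Suc.hyps(2) False by auto
      then show ?thesis by (simp add: K_def algebra_simps)
    qed
    finally show ?thesis using tree by blast
  qed
qed

text \<open>
  The bound telescopes: \<open>m powr (- \<alpha>)\<close> is at most twice the increment of \<open>m powr (1 - \<alpha>)\<close>. The
  extreme case \<open>\<alpha> = 1 / 2\<close> of the increment is the arithmetic--geometric mean inequality for
  \<open>m - 1\<close> and \<open>m\<close>.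
\<close>

lemma sum_inverse_powr_le:
  fixes \<alpha> :: real
  assumes "0 \<le> \<alpha>" "\<alpha> \<le> 1 / 2"
  shows "(\<Sum>i=1..n. real i powr (- \<alpha>)) \<le> 2 * real n powr (1 - \<alpha>)"
proof (induction n)
  case 0
  then show ?case by simp
next
  case (Suc n)
  define m where "m = real (Suc n)"
  have "2 * real n powr (1 - \<alpha>) + m powr (- \<alpha>) \<le> 2 * m powr (1 - \<alpha>)"
  proof (cases "n = 0")
    case True
    then show ?thesis by (simp add: m_def)
  next
    case False
    have m: "real n = m - 1" "0 < m - 1" using False by (auto simp: m_def)
    have "(m / (m - 1)) powr \<alpha> \<le> (m / (m - 1)) powr (1 / 2)"
      using assms m by (intro powr_mono) auto
    also have "\<dots> = sqrt m / sqrt (m - 1)"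
      using m by (simp add: powr_half_sqrt real_sqrt_divide)
    finally have "(m - 1) * (m / (m - 1)) powr \<alpha> \<le> (m - 1) * (sqrt m / sqrt (m - 1))"
      using m by (intro mult_left_mono) auto
    also have "\<dots> = sqrt (m - 1) * sqrt m"
    proof -
      have "m - 1 = sqrt (m - 1) * sqrt (m - 1)" using m by simp
      then show ?thesis using m by (simp add: field_simps)
    qed
    also have "\<dots> \<le> m - 1 / 2"
      using arith_geo_mean_sqrt[of "m - 1" m] m by (simp add: real_sqrt_mult)
    finally have *: "(m - 1) * (m / (m - 1)) powr \<alpha> \<le> m - 1 / 2" .
    have "(m - 1) powr (1 - \<alpha>) = m powr (- \<alpha>) * ((m - 1) * (m / (m - 1)) powr \<alpha>)"
      using m(2) by (simp add: powr_diff powr_minus powr_divide field_simps)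
    also have "\<dots> \<le> m powr (- \<alpha>) * (m - 1 / 2)"
      by (intro mult_left_mono *) auto
    also have "\<dots> = m powr (1 - \<alpha>) - m powr (- \<alpha>) / 2"
      using m(2) by (simp add: powr_diff powr_minus field_simps)
    finally show ?thesis using m(1) by simp
  qed
  then show ?case using Suc.IH by (simp add: m_def)
qed

lemma real_ln_Suc_le_two_sqrt:
  assumes "0 < n"
  shows "ln (real n + 1) \<le> 2 * sqrt (real n)"
proof -
  have "ln (real n + 1) \<le> ln ((1 + sqrt (real n))\<^sup>2)"
    by (subst ln_le_cancel_iff) (auto simp: power2_eq_square algebra_simps add_pos_nonneg)
  also have "\<dots> = 2 * ln (1 + sqrt (real n))"
    by (simp add: ln_realpow add_pos_nonneg)
  also have "\<dots> \<le> 2 * sqrt (real n)"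
    using ln_add_one_self_le_self[of "sqrt (real n)"] by simp
  finally show ?thesis .
qed

text \<open>
  Start the reweighting with unit weights. The initial weight is polynomial in the number of points, so
  by taking logarithms \<open>separation_number E R\<close> is at most of the order of \<open>ln n\<close> plus the sum of
  \<open>i powr (- 1 / d)\<close>. The assumption \<open>2 \<le> d\<close> makes the logarithm negligible against
  \<open>n powr (1 - 1 / d)\<close>.
\<close>

lemma leaf_tree_few_crossings:
  fixes P :: "'a::euclidean_space set"
  assumes fP: "finite P" and P: "P \<noteq> {}" and d: "2 \<le> DIM('a)"
  shows "\<exists>E. leaf_tree P E \<and> (\<forall>R\<in>halfspace_cuts P. real (separation_number E R)
    \<le> 42 * (real DIM('a) + 1) / ln 2 * real (card P) powr (1 - 1 / real DIM('a)))"
proof -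
  define X where "X = halfspace_cuts P"
  define n where "n = card P"
  define K where "K = 20 * real (Suc DIM('a))"
  define \<alpha> where "\<alpha> = 1 / real DIM('a)"
  have n: "0 < n" using fP P by (simp add: n_def card_gt_0_iff)
  have \<alpha>: "0 \<le> \<alpha>" "\<alpha> \<le> 1 / 2" using d by (auto simp: \<alpha>_def field_simps)
  have fX: "finite X"
    using fP by (intro finite_subset[of X "Pow P"]) (auto simp: X_def halfspace_cuts_def)
  obtain E where E: "leaf_tree P E" and
    tot: "(\<Sum>R\<in>X. 1 * 2 ^ separation_number E R) \<le> sum (\<lambda>_. 1) X * (\<Prod>i=2..n. 1 + K * real i powr (- \<alpha>))"
    using reweighted_leaf_tree[where w = "\<lambda>_. 1", OF fP P fX _ vc_less_dual_halfspace_cuts[OF order_refl, of P, folded X_def]]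
    unfolding K_def \<alpha>_def n_def by auto
  have bound: "real (separation_number E R) \<le> (2 * (real DIM('a) + 1) + 2 * K) / ln 2 * real n powr (1 - \<alpha>)"
    if R: "R \<in> X" for R
  proof -
    have "2 ^ separation_number E R \<le> (\<Sum>R\<in>X. 1 * 2 ^ separation_number E R :: real)"
      using member_le_sum[OF R _ fX, of "\<lambda>R. 2 ^ separation_number E R :: real"] by simp
    also note tot
    also have "sum (\<lambda>_. 1) X * (\<Prod>i=2..n. 1 + K * real i powr (- \<alpha>))
        \<le> (real n + 1) ^ (DIM('a) + 1) * (\<Prod>i=1..n. exp (K * real i powr (- \<alpha>)))"
    proof (intro mult_mono)
      have "real (card X) \<le> real ((n + 1) ^ (DIM('a) + 1))"
        unfolding X_def n_def by (intro of_nat_mono card_halfspace_cuts_le fP)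
      then show "sum (\<lambda>_. 1) X \<le> (real n + 1) ^ (DIM('a) + 1)" by (simp add: algebra_simps)
      have "(\<Prod>i=2..n. 1 + K * real i powr (- \<alpha>)) \<le> (\<Prod>i=2..n. exp (K * real i powr (- \<alpha>)))"
        by (intro prod_mono) (auto simp: K_def intro!: add_nonneg_nonneg)
      also have "\<dots> \<le> (\<Prod>i=1..n. exp (K * real i powr (- \<alpha>)))"
        by (intro prod_mono2) (auto simp: K_def)
      finally show "(\<Prod>i=2..n. 1 + K * real i powr (- \<alpha>)) \<le> (\<Prod>i=1..n. exp (K * real i powr (- \<alpha>)))" .
    qed (auto simp: K_def intro!: prod_nonneg add_nonneg_nonneg)
    also have "(\<Prod>i=1..n. exp (K * real i powr (- \<alpha>))) = exp (K * (\<Sum>i=1..n. real i powr (- \<alpha>)))"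
      by (simp add: exp_sum sum_distrib_left)
    finally have "ln (2 ^ separation_number E R)
        \<le> ln ((real n + 1) ^ (DIM('a) + 1) * exp (K * (\<Sum>i=1..n. real i powr (- \<alpha>))))"
      by (subst ln_le_cancel_iff) (auto simp: add_nonneg_pos)
    also have "\<dots> = (real DIM('a) + 1) * ln (real n + 1) + K * (\<Sum>i=1..n. real i powr (- \<alpha>))"
      by (subst ln_mult_pos) (auto simp: ln_realpow add_nonneg_pos add.commute simp del: power_Suc)
    also have "\<dots> \<le> (real DIM('a) + 1) * (2 * real n powr (1 - \<alpha>)) + K * (2 * real n powr (1 - \<alpha>))"
    proof (intro add_mono mult_left_mono sum_inverse_powr_le \<alpha>)
      have "sqrt (real n) = real n powr (1 / 2)" using n by (simp add: powr_half_sqrt)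
      also have "\<dots> \<le> real n powr (1 - \<alpha>)" using n \<alpha> by (intro powr_mono) auto
      finally show "ln (real n + 1) \<le> 2 * real n powr (1 - \<alpha>)"
        using real_ln_Suc_le_two_sqrt[OF n] by simp
    qed (auto simp: K_def)
    finally have "real (separation_number E R) * ln 2 \<le> (2 * (real DIM('a) + 1) + 2 * K) * real n powr (1 - \<alpha>)"
      by (simp add: ln_realpow algebra_simps)
    then show ?thesis by (simp add: field_simps)
  qed
  have const: "2 * (real DIM('a) + 1) + 2 * K = 42 * (real DIM('a) + 1)"
    by (simp add: K_def)
  show ?thesis
    using E bound[unfolded const] unfolding X_def n_def \<alpha>_def by blast
qed

section \<open>Points on a line\<close>

text \<open>
  On the points of \<open>P\<close>, membership in \<open>R\<close> changes at most once as \<open>f\<close> increases.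
\<close>

definition monotone_cut :: "('a \<Rightarrow> real) \<Rightarrow> 'a set \<Rightarrow> 'a set \<Rightarrow> bool" where
  "monotone_cut f P R \<longleftrightarrow>
    (\<forall>x\<in>P. \<forall>y\<in>P. f x \<le> f y \<longrightarrow> x \<in> R \<longrightarrow> y \<in> R) \<or>
    (\<forall>x\<in>P. \<forall>y\<in>P. f x \<le> f y \<longrightarrow> y \<in> R \<longrightarrow> x \<in> R)"

text \<open>
  The path that visits the points in increasing order of \<open>f\<close>. In the induction the smallest point \<open>x\<close> is
  attached to the second smallest point \<open>y\<close>; if \<open>R\<close> separates them, it does not divide the other points.
  The second conclusion is what the induction needs in that case.
\<close>

lemma sorted_path_crossings:
  fixes f :: "'a \<Rightarrow> real"
  assumes "finite P" "P \<noteq> {}"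
  shows "\<exists>E. leaf_tree P E \<and> (\<forall>R. monotone_cut f P R \<longrightarrow>
      separation_number E R \<le> 1 \<and> (P \<subseteq> R \<or> P \<inter> R = {} \<longrightarrow> separation_number E R = 0))"
  using assms
proof (induction "card P" arbitrary: P)
  case 0
  then show ?case by simp
next
  case (Suc n)
  show ?case
  proof (cases "n = 0")
    case True
    then obtain x where "P = {x}" using Suc.hyps(2) by (metis One_nat_def card_1_singletonE)
    then show ?thesis
      by (intro exI[of _ "{}"]) (auto simp: leaf_tree.root separation_number_def)
  next
    case False
    obtain x where x: "x \<in> P" "\<And>z. z \<in> P \<Longrightarrow> f x \<le> f z"
      using ex_is_arg_min_if_finite[OF Suc.prems, of f] by (auto simp: is_arg_min_linorder)
    have P': "finite (P - {x})" "P - {x} \<noteq> {}" "n = card (P - {x})"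
    proof -
      show "finite (P - {x})" "n = card (P - {x})"
        using Suc.hyps(2) Suc.prems(1) x(1) by (auto simp: card_Diff_singleton_if)
      then show "P - {x} \<noteq> {}" using False by (metis card.empty)
    qed
    obtain y where y: "y \<in> P" "y \<noteq> x" "\<And>z. z \<in> P \<Longrightarrow> z \<noteq> x \<Longrightarrow> f y \<le> f z"
      using ex_is_arg_min_if_finite[OF P'(1,2), of f] by (auto simp: is_arg_min_linorder)
    obtain E where E: "leaf_tree (P - {x}) E" and cr: "\<And>R. monotone_cut f (P - {x}) R \<Longrightarrow>
      separation_number E R \<le> 1 \<and>
      (P - {x} \<subseteq> R \<or> (P - {x}) \<inter> R = {} \<longrightarrow> separation_number E R = 0)"
      using Suc.hyps(1)[OF P'(3,1,2)] by blast
    have nE: "(x, y) \<notin> E" using leaf_tree_edges[OF E] by auto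
    have tree: "leaf_tree P (insert (x, y) E)"
      using leaf_tree.leaf[OF E, of y x] x(1) y(1,2) by (simp add: insert_absorb)
    have ins: "separation_number (insert (x, y) E) R
        = separation_number E R + (if (x \<in> R) \<noteq> (y \<in> R) then 1 else 0)" for R
      using separation_number_insert[OF _ nE] leaf_tree_finite[OF E] by blast
    have "separation_number (insert (x, y) E) R \<le> 1 \<and>
        (P \<subseteq> R \<or> P \<inter> R = {} \<longrightarrow> separation_number (insert (x, y) E) R = 0)"
      if R: "monotone_cut f P R" for R
    proof -
      have cR: "separation_number E R \<le> 1"
        "P - {x} \<subseteq> R \<or> (P - {x}) \<inter> R = {} \<Longrightarrow> separation_number E R = 0"
        using cr[of R] R by (auto simp: monotone_cut_def)
      show ?thesis
      proof (cases "(x \<in> R) = (y \<in> R)")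
        case True
        then show ?thesis using cR x(1) unfolding ins by auto
      next
        case False
        have "P - {x} \<subseteq> R \<or> (P - {x}) \<inter> R = {}"
          using R unfolding monotone_cut_def
        proof
          assume up: "\<forall>x\<in>P. \<forall>y\<in>P. f x \<le> f y \<longrightarrow> x \<in> R \<longrightarrow> y \<in> R"
          then have "y \<in> R" using False x y(1) by blast
          then show ?thesis using up y by blast
        next
          assume down: "\<forall>x\<in>P. \<forall>y\<in>P. f x \<le> f y \<longrightarrow> y \<in> R \<longrightarrow> x \<in> R"
          then have "y \<notin> R" using False x y(1) by blast
          then show ?thesis using down y by blast
        qed
        then show ?thesis using cR(2) x(1) y(1) False unfolding ins by auto
      qed
    qed
    then show ?thesis using tree by blast
  qed
qed

lemma leaf_tree_line:
  fixes P :: "(real ^ 'd) set"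
  assumes fP: "finite P" and P: "P \<noteq> {}" and d: "CARD('d) = 1"
  shows "\<exists>E. leaf_tree P E \<and> (\<forall>R\<in>halfspace_cuts P. separation_number E R \<le> 1)"
proof -
  obtain k :: 'd where k: "UNIV = {k}" using d card_1_singletonE by blast
  have inner: "a \<bullet> x = a $ k * x $ k" for a x :: "real ^ 'd"
    unfolding inner_vec_def k by simp
  obtain E where E: "leaf_tree P E" and cr: "\<And>R. monotone_cut (\<lambda>x. x $ k) P R \<Longrightarrow>
      separation_number E R \<le> 1"
    using sorted_path_crossings[OF fP P, of "\<lambda>x. x $ k"] by blast
  have "separation_number E R \<le> 1" if R_cut: "R \<in> halfspace_cuts P" for R
  proof (rule cr)
    obtain a b where R: "R = P \<inter> {x. b < a \<bullet> x}"
      using R_cut unfolding halfspace_cuts_def by blast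
    show "monotone_cut (\<lambda>x. x $ k) P R"
    proof (cases "0 \<le> a $ k")
      case True
      then show ?thesis
        unfolding monotone_cut_def R inner by (auto intro: less_le_trans mult_left_mono)
    next
      case False
      then show ?thesis
        unfolding monotone_cut_def R inner by (auto intro: less_le_trans mult_left_mono_neg)
    qed
  qed
  then show ?thesis using E by blast
qed

section \<open>Spanning trees with low crossing number\<close>

text \<open>
  In dimension 1 the logarithm of the initial weight would not be negligible, so the line is treated by
  the sorted path.
\<close>

theorem theorem6p1:
  shows "\<exists>C :: real. \<forall>n :: nat. n > 0 \<longrightarrow>
    (\<forall>P :: (real ^ 'd) set. finite P \<and> card P = n \<longrightarrow>
      (\<exists>T. geometric_spanning_tree P T \<and>
        real (crossing_number T) \<le> C * real n powr (1 - 1 / real CARD('d))))"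
proof (cases "CARD('d) = 1")
  case True
  show ?thesis
  proof (intro exI[of _ 1] allI impI, elim conjE)
    fix n :: nat and P :: "(real ^ 'd) set"
    assume n: "n > 0" and P: "finite P" "card P = n"
    then have "P \<noteq> {}" by auto
    then obtain E where E: "leaf_tree P E" "\<forall>R\<in>halfspace_cuts P. separation_number E R \<le> 1"
      using leaf_tree_line[OF P(1) _ True] by blast
    have "crossing_number (leaf_tree_graph P E) \<le> 1"
      by (rule crossing_number_leaf_tree_le[OF E(1)]) (use E(2) in blast)
    then show "\<exists>T. geometric_spanning_tree P T \<and>
        real (crossing_number T) \<le> 1 * real n powr (1 - 1 / real CARD('d))"
      using geometric_spanning_tree_leaf_tree[OF E(1)] n True
      by (intro exI[of _ "leaf_tree_graph P E"]) simp
  qed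
next
  case False
  define d where "d = CARD('d)"
  have DIM: "DIM(real ^ 'd) = d" by (simp add: d_def)
  have "0 < CARD('d)" by simp
  then have d2: "2 \<le> d" using False unfolding d_def by linarith
  define C where "C = 42 * (real d + 1) / ln 2"
  show ?thesis
  proof (intro exI[of _ C] allI impI, elim conjE)
    fix n :: nat and P :: "(real ^ 'd) set"
    assume n: "n > 0" and P: "finite P" "card P = n"
    then have "P \<noteq> {}" by auto
    then obtain E where E: "leaf_tree P E" and
      cr: "\<forall>R\<in>halfspace_cuts P. real (separation_number E R) \<le> C * real n powr (1 - 1 / real d)"
      using leaf_tree_few_crossings[OF P(1)] d2 unfolding DIM C_def P(2) by blast
    have "crossing_number (leaf_tree_graph P E) \<le> nat \<lfloor>C * real n powr (1 - 1 / real d)\<rfloor>"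
    proof (rule crossing_number_leaf_tree_le[OF E])
      fix R assume "R \<in> halfspace_cuts P"
      then show "separation_number E R \<le> nat \<lfloor>C * real n powr (1 - 1 / real d)\<rfloor>"
        using cr by (meson le_nat_floor)
    qed
    moreover have "0 \<le> C * real n powr (1 - 1 / real d)" by (simp add: C_def)
    ultimately have "real (crossing_number (leaf_tree_graph P E)) \<le> C * real n powr (1 - 1 / real d)"
      by linarith
    then show "\<exists>T. geometric_spanning_tree P T \<and>
        real (crossing_number T) \<le> C * real n powr (1 - 1 / real CARD('d))"
      using geometric_spanning_tree_leaf_tree[OF E] by (auto simp: d_def)
  qed
qed

end
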